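(* Let $\lambda$ be a partition with $l(\lambda)\le n$ and $z$ a content with $|z|=|\lambda|$, and label the semistandard tableaux of shape $\lambda$ and content $z$ as $S_1\succ S_2\succ\cdots\succ S_K$ in the row word order. Suppose $F\in F(\lambda,z)$ and $F=\sum_{i=1}^{K} a_i S_i$ in $\mathbb{C}^{F(\lambda,z)}/A(\lambda,z)$. Then, in $\mathbb{C}^{F(\lambda,z)}/A(\lambda,z)$, $$\sum_{i=1}^K a_i S_i=\sum_{j=1}^{K} R(F,S_j)\cdot D(S_j).$$
   Context: Fix $n\ge 2$, $[n]=\{1,\dots,n\}$. A partition $\lambda=(\lambda_1\ge\cdots\ge\lambda_k>0)$ is identified with its Young diagram ($\lambda_r$ left-justified boxes in row $r$); its column lengths are $\zeta_1\ge\cdots\ge\zeta_{\lambda_1}$, and $(r,c)$ ($1\le c\le\lambda_1$, $1\le r\le\zeta_c$) denotes the box in row $r$, column $c$. A filling $F$ of shape $\lambda$ assigns $F(r,c)\in[n]$ to each box; its content is $z=(z_1,\dots,z_n)$ with $z_i$ the number of boxes with value $i$. A filling is cardinal if no column has a repeated value; a tableau is a cardinal filling with columns strictly increasing downward; a semistandard tableau is a tableau with rows weakly increasing left to right. Two fillings of the same shape have the same row content if for each row the multisets of entries in that row agree. $F(\lambda,z)$ denotes the set of fillings of shape $\lambda$ and content $z$. Multipermutations: $\mathfrak{S}_\lambda=\mathfrak{S}_{\zeta_1}\times\cdots\times\mathfrak{S}_{\zeta_{\lambda_1}}$, with $\mathrm{sgn}(\underline\pi)=\prod_c\mathrm{sgn}(\pi_c)$;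 for a filling $F$ of shape $\lambda$, $F_{\underline\pi}(r,c)=F(\pi_c(r),c)$. For $F,S\in F(\lambda,z)$ the rearrangement coefficient is $R(F,S)=\sum \mathrm{sgn}(\underline\pi)$, summed over all $\underline\pi\in\mathfrak{S}_\lambda$ such that $F_{\underline\pi}$ and $S$ have the same row content. Factor space: $\mathbb{C}^{F(n)}$ is the complex vector space with basis all fillings of all shapes with entries in $[n]$, and $\mathbb{C}^{F(\lambda,z)}$ its subspace spanned by $F(\lambda,z)$. $A(n)$ is the subspace spanned by (i) all sums $E+F$ where $E,F$ have the same shape and content and differ in a single column by a single transposition of two entries, and (ii) all sums $E-\sum F'$, the sum over all fillings $F'$ obtained from $E$ by swapping the top $m$ entries of column $j+1$ with any $m$ entries of column $j$ (keeping their vertical order), for some $j,m$. $A(\lambda,z)=A(n)\cap\mathbb{C}^{F(\lambda,z)}$. The cosets of semistandard tableaux of shape $\lambda$ and content $z$ form a basis of $\mathbb{C}^{F(\lambda,z)}/A(\lambda,z)$. Row word order: $\mathrm{rw}(F)$ is the word obtained by reading the entries of each row left to right, top row first; $E\prec F$ iff $\mathrm{rw}(E)$ precedes $\mathrm{rw}(F)$ lexicographically. $K$ is the number of semistandard tableaux of shape $\lambda$, content $z$. D-basis: recursively, $D(S_i)=S_i-\sum_{j<i}R(S_i,S_j)\,D(S_j)$ in the quotient. *)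

theory Defs
  imports Complex_Main
    "HOL-Library.FuncSet"
    "HOL-Library.Multiset"
    "HOL-Library.Poly_Mapping"
    "HOL-Combinatorics.Permutations"
begin

text \<open>A filling is stored as the list of its rows, so that it carries its own shape. Boxes
  \<open>(r, c)\<close> are indexed from 1 throughout; only the list accesses are shifted.\<close>

type_synonym filling = "nat list list"

definition is_partition :: "nat list \<Rightarrow> bool" where
  "is_partition lam \<longleftrightarrow> sorted_wrt (\<ge>) lam \<and> 0 \<notin> set lam"

definition num_cols :: "nat list \<Rightarrow> nat" where
  "num_cols lam = (case lam of [] \<Rightarrow> 0 | l # _ \<Rightarrow> l)"

definition col_len :: "nat list \<Rightarrow> nat \<Rightarrow> nat" where
  "col_len lam c = card {r \<in> {1..length lam}. c \<le> lam ! (r - 1)}"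

definition shape :: "filling \<Rightarrow> nat list" where
  "shape F = map length F"

definition entry :: "filling \<Rightarrow> nat \<Rightarrow> nat \<Rightarrow> nat" where
  "entry F r c = F ! (r - 1) ! (c - 1)"

definition mk_filling :: "nat list \<Rightarrow> (nat \<Rightarrow> nat \<Rightarrow> nat) \<Rightarrow> filling" where
  "mk_filling lam f =
     map (\<lambda>r. map (\<lambda>c. f r c) [1..<Suc (lam ! (r - 1))]) [1..<Suc (length lam)]"

definition content :: "nat \<Rightarrow> filling \<Rightarrow> nat list" where
  "content n F = map (\<lambda>i. count_list (concat F) i) [1..<Suc n]"

definition all_fillings :: "nat \<Rightarrow> filling set" where
  "all_fillings n = {F. is_partition (shape F) \<and> set (concat F) \<subseteq> {1..n}}"

definition fillings :: "nat \<Rightarrow> nat list \<Rightarrow> nat list \<Rightarrow> filling set" where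
  "fillings n lam z = {F \<in> all_fillings n. shape F = lam \<and> content n F = z}"

definition cardinal :: "filling \<Rightarrow> bool" where
  "cardinal F \<longleftrightarrow> (\<forall>c \<in> {1..num_cols (shape F)}.
     inj_on (\<lambda>r. entry F r c) {1..col_len (shape F) c})"

definition tableau :: "filling \<Rightarrow> bool" where
  "tableau F \<longleftrightarrow> cardinal F \<and> (\<forall>c \<in> {1..num_cols (shape F)}.
     strict_mono_on {1..col_len (shape F) c} (\<lambda>r. entry F r c))"

definition semistandard :: "filling \<Rightarrow> bool" where
  "semistandard F \<longleftrightarrow> tableau F \<and> (\<forall>row \<in> set F. sorted row)"

definition ssyt :: "nat \<Rightarrow> nat list \<Rightarrow> nat list \<Rightarrow> filling set" where
  "ssyt n lam z = {F \<in> fillings n lam z. semistandard F}"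

definition same_row_content :: "filling \<Rightarrow> filling \<Rightarrow> bool" where
  "same_row_content E F \<longleftrightarrow> map mset E = map mset F"

definition row_word :: "filling \<Rightarrow> nat list" where
  "row_word F = concat F"

definition rw_less :: "filling \<Rightarrow> filling \<Rightarrow> bool" (infix "\<prec>" 50) where
  "E \<prec> F \<longleftrightarrow> (row_word E, row_word F) \<in> lexord {(x, y). x < y}"


definition multiperms :: "nat list \<Rightarrow> (nat \<Rightarrow> nat \<Rightarrow> nat) set" where
  "multiperms lam = (\<Pi>\<^sub>E c \<in> {1..num_cols lam}. {p. p permutes {1..col_len lam c}})"

definition multisign :: "nat list \<Rightarrow> (nat \<Rightarrow> nat \<Rightarrow> nat) \<Rightarrow> int" where
  "multisign lam p = (\<Prod>c \<in> {1..num_cols lam}. sign (p c))"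

definition permute_filling :: "(nat \<Rightarrow> nat \<Rightarrow> nat) \<Rightarrow> filling \<Rightarrow> filling" where
  "permute_filling p F = mk_filling (shape F) (\<lambda>r c. entry F (p c r) c)"

definition rearr :: "filling \<Rightarrow> filling \<Rightarrow> int" where
  "rearr F S =
     (\<Sum>p \<in> {p \<in> multiperms (shape F). same_row_content (permute_filling p F) S}.
        multisign (shape F) p)"


type_synonym fvec = "filling \<Rightarrow>\<^sub>0 complex"

definition scale :: "complex \<Rightarrow> fvec \<Rightarrow> fvec" (infixr "\<cdot>" 75) where
  "a \<cdot> v = Poly_Mapping.map ((*) a) v"

lemma lookup_scale: "Poly_Mapping.lookup (a \<cdot> v) F = a * Poly_Mapping.lookup v F"
  by (simp add: scale_def map.rep_eq when_def)

interpretation fvec: vector_space scale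
  by unfold_locales
    (auto intro!: poly_mapping_eqI simp: lookup_scale lookup_add algebra_simps)

definition vec :: "filling \<Rightarrow> fvec" where
  "vec F = Poly_Mapping.single F 1"

definition CF :: "nat \<Rightarrow> nat list \<Rightarrow> nat list \<Rightarrow> fvec set" where
  "CF n lam z = fvec.span (vec ` fillings n lam z)"


definition swap_in_col :: "filling \<Rightarrow> nat \<Rightarrow> nat \<Rightarrow> nat \<Rightarrow> filling" where
  "swap_in_col E c p q =
     mk_filling (shape E) (\<lambda>r d. if d = c then entry E (Transposition.transpose p q r) d
                                 else entry E r d)"

text \<open>The two boxes are distinct but their entries may agree. In that case the generator is
  \<open>2E\<close>, so fillings with a repeated entry in a column vanish in the quotient.\<close>

definition transposition_relations :: "nat \<Rightarrow> fvec set" where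
  "transposition_relations n =
     {vec E + vec (swap_in_col E c p q) | E c p q.
        E \<in> all_fillings n \<and> c \<in> {1..num_cols (shape E)} \<and>
        p \<in> {1..col_len (shape E) c} \<and> q \<in> {1..col_len (shape E) c} \<and> p \<noteq> q}"

text \<open>Exchange the top \<open>card B\<close> entries of column \<open>j + 1\<close> with the entries of column \<open>j\<close> in the
  rows \<open>B\<close>, keeping the vertical order: the \<open>k\<close>-th smallest row of \<open>B\<close> is paired with row \<open>k\<close>.\<close>

definition exchange :: "filling \<Rightarrow> nat \<Rightarrow> nat set \<Rightarrow> filling" where
  "exchange E j B =
     mk_filling (shape E) (\<lambda>r c.
       if c = j \<and> r \<in> B then entry E (card {b \<in> B. b \<le> r}) (Suc j)
       else if c = Suc j \<and> r \<le> card B then entry E (sorted_list_of_set B ! (r - 1)) j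
       else entry E r c)"

text \<open>The sum runs over the choices \<open>B\<close> of \<open>m\<close> boxes in column \<open>j\<close>, so a filling that arises from
  several choices is counted with multiplicity.\<close>

definition exchange_relations :: "nat \<Rightarrow> fvec set" where
  "exchange_relations n =
     {vec E - (\<Sum>B \<in> {B. B \<subseteq> {1..col_len (shape E) j} \<and> card B = m}. vec (exchange E j B)) | E j m.
        E \<in> all_fillings n \<and> 1 \<le> j \<and> Suc j \<le> num_cols (shape E) \<and>
        m \<in> {1..col_len (shape E) (Suc j)}}"

definition A_all :: "nat \<Rightarrow> fvec set" where
  "A_all n = fvec.span (transposition_relations n \<union> exchange_relations n)"

definition A_rel :: "nat \<Rightarrow> nat list \<Rightarrow> nat list \<Rightarrow> fvec set" where
  "A_rel n lam z = A_all n \<inter> CF n lam z"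


definition coset :: "nat \<Rightarrow> nat list \<Rightarrow> nat list \<Rightarrow> fvec \<Rightarrow> fvec set" where
  "coset n lam z v = {v + a | a. a \<in> A_rel n lam z}"

lemma subspace_A_rel: "fvec.subspace (A_rel n lam z)"
  by (simp add: A_rel_def A_all_def CF_def fvec.subspace_inter)

lemma coset_eq_iff: "coset n lam z v = coset n lam z w \<longleftrightarrow> v - w \<in> A_rel n lam z"
proof
  assume "coset n lam z v = coset n lam z w"
  moreover have "v \<in> coset n lam z v"
    using fvec.subspace_0[OF subspace_A_rel] by (force simp: coset_def)
  ultimately show "v - w \<in> A_rel n lam z"
    by (auto simp: coset_def)
next
  have sub: "coset n lam z x \<subseteq> coset n lam z y" if "x - y \<in> A_rel n lam z" for x y
  proof
    fix u assume "u \<in> coset n lam z x"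
    then obtain a where "a \<in> A_rel n lam z" "u = x + a"
      by (auto simp: coset_def)
    then have "(x - y) + a \<in> A_rel n lam z" "u = y + ((x - y) + a)"
      using fvec.subspace_add[OF subspace_A_rel that] by auto
    then show "u \<in> coset n lam z y"
      unfolding coset_def by blast
  qed
  assume *: "v - w \<in> A_rel n lam z"
  then have "w - v \<in> A_rel n lam z"
    using fvec.subspace_neg[OF subspace_A_rel] by fastforce
  with * show "coset n lam z v = coset n lam z w"
    using sub by blast
qed

text \<open>The class of a linear combination depends only on the classes of its terms. So the
  recursion below, carried out on representatives, is the recursion in the quotient.\<close>

lemma coset_lincomb_cong:
  assumes "coset n lam z v = coset n lam z v'" "coset n lam z w = coset n lam z w'"
  shows "coset n lam z (v + a \<cdot> w) = coset n lam z (v' + a \<cdot> w')"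
proof -
  have "(v - v') + a \<cdot> (w - w') \<in> A_rel n lam z"
    using assms unfolding coset_eq_iff
    by (intro fvec.subspace_add[OF subspace_A_rel] fvec.subspace_scale[OF subspace_A_rel])
  then show ?thesis
    by (simp add: coset_eq_iff fvec.scale_right_diff_distrib algebra_simps)
qed

text \<open>\<open>D_rep S i\<close> represents \<open>D(S\<^sub>i)\<close>, where \<open>S\<close> is the labelling of the semistandard tableaux
  from 1 upwards.\<close>

fun D_rep :: "(nat \<Rightarrow> filling) \<Rightarrow> nat \<Rightarrow> fvec" where
  "D_rep S i = vec (S i) - (\<Sum>j \<in> {1..<i}. of_int (rearr (S i) (S j)) \<cdot> D_rep S j)"

declare D_rep.simps [simp del]

end

theory Submission
  imports Defs
begin

text \<open>Extended linearly, \<open>F \<mapsto> R(F, S)\<close> is a coefficient of the product of the column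
  minors of a generic matrix selected by \<open>F\<close>, so it vanishes on all the relations: on the
  transpositions because determinants alternate, on the exchanges by Sylvester's identity.
  Hence \<open>R(F, S\<^sub>j) = \<Sum>\<^sub>i a\<^sub>i R(S\<^sub>i, S\<^sub>j)\<close>. On semistandard tableaux, \<open>R\<close> is unitriangular
  for the row word order: a permutation inside columns can only increase the first row it changes.
  So the recursion for \<open>D\<close> reads \<open>S\<^sub>i = \<Sum>\<^sub>j R(S\<^sub>i, S\<^sub>j) D(S\<^sub>j)\<close>, and it remains to exchange two sums.

  For the exchanges, combining a multipermutation with the exchanged rows gives a permutation of
  all boxes that moves the top \<open>m\<close> boxes of column \<open>j + 1\<close> to column \<open>j\<close>. Signed sums over
  such permutations change sign whenever one more box is moved, since letting that
  box go to either column makes the sum vanish.\<close>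

section \<open>Boxes of a diagram, and fillings rearranged by permutations of boxes\<close>

definition boxes :: "nat list \<Rightarrow> (nat \<times> nat) set" where
  "boxes lam = {(r, c). c \<in> {1..num_cols lam} \<and> r \<in> {1..col_len lam c}}"

definition box_entry :: "filling \<Rightarrow> nat \<times> nat \<Rightarrow> nat" where
  "box_entry F b = entry F (fst b) (snd b)"

definition rearrange :: "filling \<Rightarrow> (nat \<times> nat \<Rightarrow> nat \<times> nat) \<Rightarrow> filling" where
  "rearrange F w = mk_filling (shape F) (\<lambda>r c. box_entry F (w (r, c)))"

text \<open>The box \<open>w b\<close> of \<open>F\<close> is moved to the position \<open>b\<close>, so \<open>Al\<close> gives the columns to
  which each box may move.\<close>

definition placements ::
  "nat list \<Rightarrow> (nat \<times> nat \<Rightarrow> nat set) \<Rightarrow> (nat \<times> nat \<Rightarrow> nat \<times> nat) set" where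
  "placements lam Al = {w. w permutes boxes lam \<and> (\<forall>b \<in> boxes lam. snd b \<in> Al (w b))}"

text \<open>Letting boxes change columns puts \<open>rearr\<close> and the exchange sums into one
  family. The row-content condition is a factor, not part of the index set, so a reindexing only has
  to respect \<open>Al\<close>.\<close>

definition signed_count :: "filling \<Rightarrow> filling \<Rightarrow> (nat \<times> nat \<Rightarrow> nat set) \<Rightarrow> int" where
  "signed_count F S Al =
     (\<Sum>w \<in> placements (shape F) Al. sign w * of_bool (same_row_content (rearrange F w) S))"

text \<open>Row lengths weakly decrease, so the rows that reach column \<open>c\<close> form an
  initial segment, whose size is the index of its last row.\<close>

lemma col_len_ge_iff:
  assumes "is_partition lam" "r \<in> {1..length lam}"
  shows "r \<le> col_len lam c \<longleftrightarrow> c \<le> lam ! (r - 1)"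
proof
  have mono: "lam ! (s - 1) \<le> lam ! (t - 1)" if "1 \<le> t" "t \<le> s" "s \<le> length lam" for s t
    using assms(1) that
    by (cases "s = t") (auto simp: is_partition_def sorted_wrt_iff_nth_less)
  {
    assume "c \<le> lam ! (r - 1)"
    then have "{1..r} \<subseteq> {r \<in> {1..length lam}. c \<le> lam ! (r - 1)}"
      using assms(2) mono[of _ r] by auto (metis One_nat_def order_trans)
    from card_mono[OF _ this] show "r \<le> col_len lam c"
      by (simp add: col_len_def)
  }
  {
    assume r: "r \<le> col_len lam c"
    show "c \<le> lam ! (r - 1)"
    proof (rule ccontr)
      assume "\<not> c \<le> lam ! (r - 1)"
      then have "s < r" if "s \<in> {1..length lam}" "c \<le> lam ! (s - 1)" for s
        using mono[of r s] that assms(2) by (cases "s < r") auto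
      then have "{r \<in> {1..length lam}. c \<le> lam ! (r - 1)} \<subseteq> {1..r - 1}"
        by force
      from card_mono[OF _ this] r assms(2) show False
        by (auto simp: col_len_def)
    qed
  }
qed

text \<open>Translates between columns, in which the permutations act, and rows, from which
  \<open>mk_filling\<close> builds. The bound by \<open>num_cols lam\<close> comes from the first
  row being the longest.\<close>

lemma boxes_iff:
  assumes "is_partition lam"
  shows "(r, c) \<in> boxes lam \<longleftrightarrow> r \<in> {1..length lam} \<and> c \<in> {1..lam ! (r - 1)}"
proof -
  have "col_len lam c \<le> card {1..length lam}"
    unfolding col_len_def by (rule card_mono) auto
  moreover have "lam ! (r - 1) \<le> num_cols lam" if "r \<in> {1..length lam}"
    using assms that
    by (cases lam; cases "r - 1") (auto simp: num_cols_def is_partition_def)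
  ultimately show ?thesis
    using col_len_ge_iff[OF assms, of r c] by (fastforce simp: boxes_def)
qed

lemma finite_boxes [simp]: "finite (boxes lam)"
proof -
  have "boxes lam = (\<Union>c\<in>{1..num_cols lam}. (\<lambda>r. (r, c)) ` {1..col_len lam c})"
    by (auto simp: boxes_def)
  then show ?thesis
    by simp
qed

lemma col_len_Suc_le: "col_len lam (Suc j) \<le> col_len lam j"
  unfolding col_len_def by (rule card_mono) auto

lemma finite_placements [simp]: "finite (placements lam Al)"
  by (rule finite_subset[OF _ finite_permutations[OF finite_boxes[of lam]]])
    (auto simp: placements_def)

lemma permutation_placement: "w \<in> placements lam Al \<Longrightarrow> permutation w"
  by (auto simp: placements_def intro: permutes_imp_permutation[OF finite_boxes])

lemma shape_mk_filling [simp]: "shape (mk_filling lam f) = lam"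
  by (auto simp: shape_def mk_filling_def simp del: upt_Suc intro!: nth_equalityI)

lemma shape_rearrange [simp]: "shape (rearrange F w) = shape F"
  by (simp add: rearrange_def)

lemma nth_mk_filling:
  "r \<in> {1..length lam} \<Longrightarrow> mk_filling lam f ! (r - 1) = map (f r) [1..<Suc (lam ! (r - 1))]"
  by (auto simp: mk_filling_def simp del: upt_Suc)

lemma entry_mk_filling:
  assumes "is_partition lam" "(r, c) \<in> boxes lam"
  shows "entry (mk_filling lam f) r c = f r c"
proof -
  have "r \<in> {1..length lam}" "c \<in> {1..lam ! (r - 1)}"
    using assms by (auto simp: boxes_iff)
  then show ?thesis
    unfolding entry_def by (subst nth_mk_filling) (auto simp del: upt_Suc)
qed

lemma mk_filling_cong:
  assumes "is_partition lam" "\<And>r c. (r, c) \<in> boxes lam \<Longrightarrow> f r c = g r c"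
  shows "mk_filling lam f = mk_filling lam g"
  using assms(2) unfolding mk_filling_def
  by (auto simp: boxes_iff[OF assms(1)] simp del: upt_Suc)

lemma mk_filling_entry: "mk_filling (shape E) (entry E) = E"
  by (rule nth_equalityI)
    (auto simp: mk_filling_def shape_def entry_def simp del: upt_Suc intro!: nth_equalityI)

lemma rearrange_id: "rearrange F id = F"
  using mk_filling_entry[of F] by (simp add: rearrange_def box_entry_def)

text \<open>Position \<open>b\<close> reads box \<open>w b\<close> of \<open>rearrange F v\<close>,
  which in turn reads box \<open>v (w b)\<close> of \<open>F\<close>.\<close>

lemma rearrange_rearrange:
  assumes "is_partition (shape F)" "w permutes boxes (shape F)"
  shows "rearrange (rearrange F v) w = rearrange F (v \<circ> w)"
  unfolding rearrange_def[of _ w] rearrange_def[of _ "v \<circ> w"] shape_rearrange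
proof (rule mk_filling_cong[OF assms(1)])
  fix r c assume "(r, c) \<in> boxes (shape F)"
  then have "w (r, c) \<in> boxes (shape F)"
    using permutes_in_image[OF assms(2)] by blast
  then show "box_entry (rearrange F v) (w (r, c)) = box_entry F ((v \<circ> w) (r, c))"
    by (cases "w (r, c)") (simp add: rearrange_def box_entry_def entry_mk_filling assms(1))
qed

lemma nth_rearrange:
  "r \<in> {1..length (shape F)} \<Longrightarrow>
     rearrange F w ! (r - 1) = map (\<lambda>c. box_entry F (w (r, c))) [1..<Suc (shape F ! (r - 1))]"
  unfolding rearrange_def by (rule nth_mk_filling)

lemma same_row_content_iff:
  assumes "shape E = shape F"
  shows "same_row_content E F \<longleftrightarrow> (\<forall>r \<in> {1..length (shape F)}. mset (E ! (r - 1)) = mset (F ! (r - 1)))"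
proof -
  have len: "length E = length F"
    using arg_cong[OF assms, of length] by (simp add: shape_def)
  have "same_row_content E F \<longleftrightarrow> (\<forall>i < length F. mset (E ! i) = mset (F ! i))"
    by (auto simp: same_row_content_def list_eq_iff_nth_eq len)
  also have "\<dots> \<longleftrightarrow> (\<forall>r \<in> {1..length F}. mset (E ! (r - 1)) = mset (F ! (r - 1)))"
  proof safe
    fix i assume *: "\<forall>r \<in> {1..length F}. mset (E ! (r - 1)) = mset (F ! (r - 1))" "i < length F"
    then show "mset (E ! i) = mset (F ! i)"
      using bspec[OF *(1), of "Suc i"] by auto
  qed auto
  finally show ?thesis
    by (simp add: shape_def)
qed

section \<open>Multipermutations as permutations of boxes\<close>

text \<open>Build \<open>p\<close> from transpositions: each one lifts to a transposition of two
  boxes of column \<open>c\<close>, so the signs agree.\<close>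

lemma lift_column_permutes_sign:
  fixes p :: "nat \<Rightarrow> nat" and c :: nat
  assumes "p permutes R" "finite R"
  defines "l \<equiv> \<lambda>p (r, c'). if c' = c then (p r, c) else (r, c')"
  shows "l p permutes (\<lambda>r. (r, c)) ` R \<and> sign (l p) = sign p"
  using assms(1,2)
proof (induction rule: permutes_induct)
  case id
  have "l id = id" by (auto simp: l_def)
  then show ?case by (simp only: permutes_id sign_id)
next
  case (swap a b p)
  have eq: "l (Transposition.transpose a b \<circ> p) = Transposition.transpose (a, c) (b, c) \<circ> l p"
    by (auto simp: l_def fun_eq_iff transpose_def)
  have t: "Transposition.transpose (a, c) (b, c) permutes (\<lambda>r. (r, c)) ` R"
    using swap by (intro permutes_swap_id) auto
  have "permutation (l p)" "permutation p"
    using swap assms(2) by (auto intro: permutes_imp_permutation)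
  then have "sign (l (Transposition.transpose a b \<circ> p)) = sign (Transposition.transpose a b \<circ> p)"
    using swap by (simp only: eq sign_compose permutation_swap_id sign_swap_id) simp
  moreover have "l (Transposition.transpose a b \<circ> p) permutes (\<lambda>r. (r, c)) ` R"
    unfolding eq using swap t by (intro permutes_compose) auto
  ultimately show ?case
    by blast
qed

text \<open>Restricting to a set \<open>C\<close> of columns allows induction on \<open>C\<close>,
  one column at a time.\<close>

definition column_map :: "nat set \<Rightarrow> (nat \<Rightarrow> nat \<Rightarrow> nat) \<Rightarrow> nat \<times> nat \<Rightarrow> nat \<times> nat" where
  "column_map C p = (\<lambda>(r, c). if c \<in> C then (p c r, c) else (r, c))"

text \<open>A new column contributes one more factor, the lift of its permutation, and signs
  multiply.\<close>

lemma column_map_permutes_sign: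
  assumes "finite C" "\<And>c. c \<in> C \<Longrightarrow> p c permutes R c" "\<And>c. c \<in> C \<Longrightarrow> finite (R c)"
  shows "column_map C p permutes {(r, c). c \<in> C \<and> r \<in> R c} \<and>
         sign (column_map C p) = (\<Prod>c\<in>C. sign (p c))"
  using assms
proof (induction C rule: finite_induct)
  case empty
  have "column_map {} p = id" by (auto simp: column_map_def)
  then show ?case by (simp only: permutes_id sign_id prod.empty)
next
  case (insert c C)
  define l where "l = (\<lambda>p (r :: nat, c'). if c' = c then (p r, c) else (r, c'))"
  have fin: "finite {(r, c). c \<in> C \<and> r \<in> R c}"
  proof -
    have "{(r, c). c \<in> C \<and> r \<in> R c} = (\<Union>c\<in>C. (\<lambda>r. (r, c)) ` R c)" by auto
    then show ?thesis using insert by auto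
  qed
  have eq: "column_map (insert c C) p = column_map C p \<circ> l (p c)"
    using insert(2) by (auto simp: l_def fun_eq_iff column_map_def)
  have IH: "column_map C p permutes {(r, c). c \<in> C \<and> r \<in> R c}"
     "sign (column_map C p) = (\<Prod>c\<in>C. sign (p c))"
    using insert by auto
  have l: "l (p c) permutes (\<lambda>r. (r, c)) ` R c" "sign (l (p c)) = sign (p c)"
    using lift_column_permutes_sign[of "p c" "R c" c] insert by (auto simp: l_def)
  have "permutation (column_map C p)" "permutation (l (p c))"
    using insert.prems
    by (auto intro: permutes_imp_permutation[OF fin IH(1)] permutes_imp_permutation[OF _ l(1)])
  moreover have "column_map C p permutes {(r, c'). c' \<in> insert c C \<and> r \<in> R c'}"
      "l (p c) permutes {(r, c'). c' \<in> insert c C \<and> r \<in> R c'}"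
    by (rule permutes_subset[OF IH(1)], force, rule permutes_subset[OF l(1)], force)
  ultimately show ?case
    unfolding eq using insert(1,2) IH(2) l(2)
    by (simp only: sign_compose) (simp add: permutes_compose[unfolded o_def] mult.commute o_def)
qed

text \<open>Converse direction: \<open>w\<close> preserves the second coordinate everywhere, hence
  so does its inverse, and bijectivity passes to each column.\<close>

lemma column_permutes:
  assumes w: "w permutes B" and "\<And>b. b \<in> B \<Longrightarrow> snd (w b) = snd b"
  shows "(\<lambda>r. fst (w (r, c))) permutes {r. (r, c) \<in> B}"
proof -
  have snd: "snd (w b) = snd b" for b
    using assms permutes_not_in[OF w] by (cases "b \<in> B") auto
  have pair: "w (r, c) = (fst (w (r, c)), c)" for r
    using snd[of "(r, c)"] by (cases "w (r, c)") auto
  have "\<exists>!r. fst (w (r, c)) = y" for y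
  proof (rule ex_ex1I)
    have "w (inv w (y, c)) = (y, c)"
      using permutes_inverses[OF w] by simp
    moreover have "inv w (y, c) = (fst (inv w (y, c)), c)"
      using snd[of "inv w (y, c)"] calculation by (metis prod.collapse snd_conv)
    ultimately show "\<exists>r. fst (w (r, c)) = y"
      by (metis fst_conv)
  next
    fix r s assume "fst (w (r, c)) = y" "fst (w (s, c)) = y"
    then have "w (r, c) = w (s, c)"
      using pair by metis
    then show "r = s"
      using permutes_inj[OF w] by (auto dest: injD)
  qed
  then show ?thesis
    using permutes_not_in[OF w] by (auto simp: permutes_def)
qed

lemma rearr_eq_signed_count:
  assumes part: "is_partition (shape F)"
  shows "rearr F S = signed_count F S (\<lambda>b. {snd b})"
proof -
  define lam where "lam = shape F"
  define C where "C = {1..num_cols lam}"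
  have colP: "column_map C p permutes boxes lam" "sign (column_map C p) = multisign lam p"
    if "p \<in> multiperms lam" for p
  proof -
    have "p c permutes {1..col_len lam c}" if "c \<in> C" for c
      using \<open>p \<in> multiperms lam\<close> that by (auto simp: multiperms_def C_def)
    from column_map_permutes_sign[of C p "\<lambda>c. {1..col_len lam c}", OF _ this]
    show "column_map C p permutes boxes lam" "sign (column_map C p) = multisign lam p"
      by (auto simp: C_def boxes_def multisign_def)
  qed
  have fill: "permute_filling p F = rearrange F (column_map C p)" for p
    unfolding permute_filling_def rearrange_def
    by (rule mk_filling_cong[OF part])
      (auto simp: column_map_def box_entry_def boxes_def C_def lam_def)
  have fin: "finite (multiperms lam)"
    unfolding multiperms_def by (intro finite_PiE) (auto intro: finite_permutations)
  have "rearr F S = (\<Sum>p\<in>multiperms lam.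
      multisign lam p * of_bool (same_row_content (permute_filling p F) S))"
    unfolding rearr_def lam_def[symmetric]
    by (rule sum.mono_neutral_cong_left) (use fin in auto)
  also have "\<dots> = signed_count F S (\<lambda>b. {snd b})"
    unfolding signed_count_def lam_def[symmetric]
  \<comment> \<open>The inverse reads a permutation off each column; it is restricted to
    \<open>C\<close> because the members of \<open>multiperms\<close> are extensional.\<close>
  proof (rule sum.reindex_bij_witness[where
        j = "column_map C" and i = "\<lambda>w. \<lambda>c\<in>C. \<lambda>r. fst (w (r, c))"])
    fix p assume p: "p \<in> multiperms lam"
    then show "(\<lambda>c\<in>C. \<lambda>r. fst (column_map C p (r, c))) = p"
      by (auto simp: column_map_def multiperms_def C_def PiE_def extensional_def fun_eq_iff)
    show "column_map C p \<in> placements lam (\<lambda>b. {snd b})"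
      using colP(1)[OF p] by (auto simp: placements_def column_map_def)
    show "sign (column_map C p) * of_bool (same_row_content (rearrange F (column_map C p)) S) =
         multisign lam p * of_bool (same_row_content (permute_filling p F) S)"
      by (simp add: colP(2)[OF p] fill)
  next
    fix w assume w: "w \<in> placements lam (\<lambda>b. {snd b})"
    then have w': "w permutes boxes lam" "\<And>b. b \<in> boxes lam \<Longrightarrow> snd (w b) = snd b"
      by (auto simp: placements_def)
    have snd: "snd (w b) = snd b" for b
      using w' permutes_not_in[OF w'(1)] by (cases "b \<in> boxes lam") auto
    have "{r. (r, c) \<in> boxes lam} = {1..col_len lam c}" if "c \<in> C" for c
      using that by (auto simp: boxes_def C_def)
    then show "(\<lambda>c\<in>C. \<lambda>r. fst (w (r, c))) \<in> multiperms lam"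
      using column_permutes[OF w'] unfolding multiperms_def C_def
      by (metis (no_types, lifting) mem_Collect_eq restrict_PiE_iff)
    have "w (r, c) = (r, c)" if "c \<notin> C" for r c
      using permutes_not_in[OF w'(1)] that by (auto simp: boxes_def C_def)
    then show "column_map C (\<lambda>c\<in>C. \<lambda>r. fst (w (r, c))) = w"
      using snd by (auto simp: column_map_def fun_eq_iff prod_eq_iff)
  qed
  finally show ?thesis .
qed

section \<open>Alternation\<close>

lemma swap_in_col_eq_rearrange:
  assumes "is_partition (shape E)"
  shows "swap_in_col E c p q = rearrange E (Transposition.transpose (p, c) (q, c))"
  unfolding swap_in_col_def rearrange_def
  by (rule mk_filling_cong[OF assms]) (auto simp: transpose_def box_entry_def)

text \<open>The swap is a transposition \<open>t\<close> of two boxes in one column, so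
  \<open>w\<close> to \<open>t \<circ> w\<close> is a sign-reversing involution of the
  column-preserving placements.\<close>

lemma rearr_swap_in_col:
  assumes part: "is_partition (shape E)" and c: "c \<in> {1..num_cols (shape E)}"
    and pq: "p \<in> {1..col_len (shape E) c}" "q \<in> {1..col_len (shape E) c}" "p \<noteq> q"
  shows "rearr (swap_in_col E c p q) S = - rearr E S"
proof -
  define t where "t = Transposition.transpose (p, c) (q, c)"
  let ?P = "placements (shape E) (\<lambda>b. {snd b})"
  have t: "t permutes boxes (shape E)"
    unfolding t_def using c pq by (intro permutes_swap_id) (auto simp: boxes_def)
  have tt: "t (t b) = b" "snd (t b) = snd b" for b
    by (auto simp: t_def transpose_def)
  have tP: "t \<circ> w \<in> ?P" if "w \<in> ?P" for w
    using that t by (auto simp: placements_def tt intro: permutes_compose)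
  have "rearr (swap_in_col E c p q) S =
      (\<Sum>w\<in>?P. sign w * of_bool (same_row_content (rearrange E (t \<circ> w)) S))"
    using part by (auto simp: rearr_eq_signed_count signed_count_def swap_in_col_eq_rearrange
        rearrange_rearrange placements_def simp flip: t_def intro!: sum.cong)
  also have "\<dots> = (\<Sum>w\<in>?P. - (sign w * of_bool (same_row_content (rearrange E w) S)))"
  proof (rule sum.reindex_bij_witness[where i = "\<lambda>w. t \<circ> w" and j = "\<lambda>w. t \<circ> w"])
    fix w assume w: "w \<in> ?P"
    have "permutation t"
      using permutes_imp_permutation[OF _ t] by simp
    moreover have "sign t = -1"
      using pq by (simp add: t_def sign_swap_id)
    ultimately have "sign (t \<circ> w) = - sign w"
      using permutation_placement[OF w] by (simp add: sign_compose)
    then show "- (sign (t \<circ> w) * of_bool (same_row_content (rearrange E (t \<circ> w)) S)) =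
      sign w * of_bool (same_row_content (rearrange E (t \<circ> w)) S)"
      by simp
  qed (auto simp: tP tt fun_eq_iff)
  also have "\<dots> = - rearr E S"
    using part by (simp add: rearr_eq_signed_count signed_count_def sum_negf)
  finally show ?thesis .
qed

section \<open>The exchange relation\<close>

lemma image_mset_transpose_atLeastLessThan:
  assumes "a < n" "b < n" "m \<le> a" "m \<le> b"
  shows "image_mset (Transposition.transpose a b) (mset [m..<n]) = mset [m..<n]"
proof -
  have "Transposition.transpose a b ` {m..<n} = {m..<n}"
    using assms by (intro transpose_image_eq) auto
  then show ?thesis
    by (simp add: image_mset_mset_set)
qed

text \<open>The right factor of a composition acts on positions, so this transposition only permutes
  entries within row \<open>r\<close>.\<close>

lemma same_row_content_row_swap:
  assumes part: "is_partition (shape F)"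
    and b: "(r, c) \<in> boxes (shape F)" "(r, d) \<in> boxes (shape F)"
  shows "same_row_content (rearrange F (w \<circ> Transposition.transpose (r, c) (r, d))) (rearrange F w)"
    (is "same_row_content (rearrange F ?w') _")
proof -
  have "mset (rearrange F ?w' ! (i - 1)) = mset (rearrange F w ! (i - 1))"
    if i: "i \<in> {1..length (shape F)}" for i
  proof (cases "i = r")
    case True
    let ?n = "Suc (shape F ! (r - 1))"
    have "mset (rearrange F ?w' ! (r - 1)) =
        image_mset (\<lambda>e. box_entry F (?w' (r, e))) (mset [1..<?n])"
      using i True by (simp only: nth_rearrange mset_map)
    also have "(\<lambda>e. box_entry F (?w' (r, e))) =
        (\<lambda>e. box_entry F (w (r, e))) \<circ> Transposition.transpose c d"
      by (auto simp: transpose_def)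
    also have "image_mset \<dots> (mset [1..<?n]) =
        image_mset (\<lambda>e. box_entry F (w (r, e)))
          (image_mset (Transposition.transpose c d) (mset [1..<?n]))"
      by (simp only: multiset.map_comp)
    also have "image_mset (Transposition.transpose c d) (mset [1..<?n]) = mset [1..<?n]"
      using b by (intro image_mset_transpose_atLeastLessThan) (auto simp: boxes_iff part)
    finally show ?thesis
      using i True by (simp only: nth_rearrange mset_map)
  next
    case False
    then show ?thesis
      using i by (simp only: nth_rearrange) (simp add: transpose_def)
  qed
  then show ?thesis
    by (subst same_row_content_iff) simp_all
qed

text \<open>The argument \<open>b\<close> is the original box. Boxes of column \<open>j\<close> may
  go to either column, filling the room that is left; in column \<open>j + 1\<close>, the rows in
  \<open>U\<close> are free, the other rows in \<open>T\<close> must move to column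
  \<open>j\<close>, and the rest stay.\<close>

definition exchange_cols :: "nat \<Rightarrow> nat set \<Rightarrow> nat set \<Rightarrow> nat \<times> nat \<Rightarrow> nat set" where
  "exchange_cols j T U b =
     (if snd b = j \<or> snd b = Suc j \<and> fst b \<in> U then {j, Suc j}
      else if snd b = Suc j then (if fst b \<in> T then {j} else {Suc j})
      else {snd b})"

text \<open>Fewer than \<open>col_len lam (Suc j)\<close> boxes are confined to one column, so by pigeonhole some
  row carries two unconfined boxes in columns \<open>j\<close> and \<open>j + 1\<close>; swapping the two
  in the topmost such row is a sign-reversing involution that keeps the row content.\<close>

lemma signed_count_free_eq_0:
  assumes part: "is_partition (shape F)" and j: "1 \<le> j" "Suc j \<le> num_cols (shape F)"
    and t: "t \<in> {1..col_len (shape F) (Suc j)}"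
  shows "signed_count F S (exchange_cols j T {t}) = 0"
proof -
  let ?Al = "exchange_cols j T {t}"
  let ?P = "placements (shape F) ?Al"
  define q where "q = col_len (shape F) (Suc j)"
  define free where "free b \<longleftrightarrow> snd b = j \<or> b = (t, Suc j)" for b :: "nat \<times> nat"
  define good where "good w r \<longleftrightarrow> r \<in> {1..q} \<and> free (w (r, j)) \<and> free (w (r, Suc j))" for w r
  define row where "row w = (LEAST r. good w r)" for w
  define sw where "sw w = w \<circ> Transposition.transpose (row w, j) (row w, Suc j)" for w
  have box: "(r, j) \<in> boxes (shape F)" "(r, Suc j) \<in> boxes (shape F)" if "r \<in> {1..q}" for r
    using j that col_len_Suc_le[of "shape F" j] by (auto simp: boxes_def q_def)
  have free_Al: "?Al b = {j, Suc j}" if "free b" for b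
    using that by (auto simp: free_def exchange_cols_def)
  have ex: "\<exists>r. good w r" if "w \<in> ?P" for w
  proof (rule ccontr)
    assume no: "\<nexists>r. good w r"
    have w: "w permutes boxes (shape F)" "\<And>b. b \<in> boxes (shape F) \<Longrightarrow> snd b \<in> ?Al (w b)"
      using that by (auto simp: placements_def)
    \<comment> \<open>One of the two positions in row \<open>r\<close> receives a box that is not
      free. Only boxes of columns \<open>j\<close> and \<open>j + 1\<close> can arrive there, so it
      comes from column \<open>j + 1\<close>, from a row other than \<open>t\<close>.\<close>
    have "\<exists>b. fst b = r \<and> snd (w b) = Suc j \<and> fst (w b) \<in> {1..q} - {t}" if r: "r \<in> {1..q}" for r
    proof -
      from no r obtain b where b: "b \<in> {(r, j), (r, Suc j)}" "\<not> free (w b)"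
        unfolding good_def by blast
      then have bb: "b \<in> boxes (shape F)" "snd b \<in> {j, Suc j}"
        using box[OF r] by auto
      have "snd b \<in> ?Al (w b)"
        by (rule w(2)[OF bb(1)])
      then have "snd (w b) = Suc j"
        using b(2) bb(2) by (auto simp: exchange_cols_def free_def split: if_splits)
      moreover have "w b \<in> boxes (shape F)"
        using permutes_in_image[OF w(1)] bb(1) by blast
      ultimately have "fst (w b) \<in> {1..q} - {t}"
        using b(2) by (cases "w b") (auto simp: boxes_def q_def free_def)
      then show ?thesis
        using b(1) \<open>snd (w b) = Suc j\<close> by auto
    qed
    then obtain f where f: "\<And>r. r \<in> {1..q} \<Longrightarrow>
        fst (f r) = r \<and> snd (w (f r)) = Suc j \<and> fst (w (f r)) \<in> {1..q} - {t}"
      by metis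
    have "inj_on (\<lambda>r. fst (w (f r))) {1..q}"
    proof (rule inj_onI)
      fix r s assume rs: "r \<in> {1..q}" "s \<in> {1..q}" "fst (w (f r)) = fst (w (f s))"
      then have "w (f r) = w (f s)"
        using f by (simp add: prod_eq_iff)
      then have "f r = f s"
        using permutes_inj[OF w(1)] by (auto dest: injD)
      then show "r = s"
        using f rs by metis
    qed
    moreover have "(\<lambda>r. fst (w (f r))) ` {1..q} \<subseteq> {1..q} - {t}"
      using f by blast
    ultimately have "card {1..q} \<le> card ({1..q} - {t})"
      by (intro card_inj_on_le) auto
    then show False
      using t by (auto simp: q_def)
  qed
  have good_row: "good w (row w)" if "w \<in> ?P" for w
    unfolding row_def using ex[OF that] by (auto intro: LeastI_ex)
  \<comment> \<open>\<open>good\<close> is symmetric in the two swapped positions and other rows are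
    untouched. So the least good row survives the swap, which makes \<open>sw\<close> an
    involution.\<close>
  have good_sw: "good (sw w) = good w" for w
    by (auto simp: good_def sw_def transpose_def fun_eq_iff)
  then have row_sw: "row (sw w) = row w" for w
    by (simp add: row_def)
  have sw_sw: "sw (sw w) = w" for w
    by (simp add: sw_def[of "sw w"] row_sw) (simp add: sw_def o_assoc [symmetric] fun_eq_iff)
  have sw_P: "sw w \<in> ?P" if w: "w \<in> ?P" for w
  proof -
    have g: "row w \<in> {1..q}" "free (w (row w, j))" "free (w (row w, Suc j))"
      using good_row[OF w] by (auto simp: good_def)
    have "sw w permutes boxes (shape F)"
      unfolding sw_def using w box[OF g(1)]
      by (intro permutes_compose permutes_swap_id) (auto simp: placements_def)
    moreover have "snd b \<in> ?Al (sw w b)" if "b \<in> boxes (shape F)" for b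
      using w g that
      by (cases "b \<in> {(row w, j), (row w, Suc j)}")
        (auto simp: sw_def free_Al placements_def transpose_def)
    ultimately show ?thesis
      by (simp add: placements_def)
  qed
  have "signed_count F S ?Al =
      (\<Sum>w\<in>?P. - (sign w * of_bool (same_row_content (rearrange F w) S)))"
    unfolding signed_count_def
  proof (rule sum.reindex_bij_witness[where i = sw and j = sw])
    fix w assume w: "w \<in> ?P"
    have r: "row w \<in> {1..q}"
      using good_row[OF w] by (auto simp: good_def)
    have "sign (sw w) = - sign w"
      unfolding sw_def
      by (simp add: sign_compose permutation_placement[OF w] permutation_swap_id sign_swap_id)
    moreover have "same_row_content (rearrange F (sw w)) (rearrange F w)"
      unfolding sw_def by (rule same_row_content_row_swap[OF part box[OF r]])
    ultimately show "- (sign (sw w) * of_bool (same_row_content (rearrange F (sw w)) S)) =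
        sign w * of_bool (same_row_content (rearrange F w) S)"
      by (simp add: same_row_content_def)
  qed (use sw_sw sw_P in auto)
  also have "\<dots> = - signed_count F S ?Al"
    by (simp add: signed_count_def sum_negf)
  finally show ?thesis
    by simp
qed

text \<open>Split the vanishing sum with box \<open>(t, Suc j)\<close> free by the column where that
  box lands: column \<open>j\<close> gives \<open>insert t T\<close>, column \<open>j + 1\<close>
  gives \<open>T\<close>.\<close>

lemma signed_count_insert:
  assumes part: "is_partition (shape F)" and j: "1 \<le> j" "Suc j \<le> num_cols (shape F)"
    and t: "t \<in> {1..col_len (shape F) (Suc j)}" "t \<notin> T"
  shows "signed_count F S (exchange_cols j (insert t T) {}) =
         - signed_count F S (exchange_cols j T {})"
proof -
  let ?lam = "shape F"
  let ?A = "placements ?lam (exchange_cols j (insert t T) {})"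
  let ?B = "placements ?lam (exchange_cols j T {})"
  let ?C = "placements ?lam (exchange_cols j T {t})"
  have tb: "(t, Suc j) \<in> boxes ?lam"
    using j t by (auto simp: boxes_def)
  \<comment> \<open>\<open>inv w (t, Suc j)\<close> is the position that receives box
    \<open>(t, Suc j)\<close>.\<close>
  have at: "snd (inv w (t, Suc j)) \<in> Al (t, Suc j)" if "w \<in> placements ?lam Al" for w Al
  proof -
    have w: "w permutes boxes ?lam" "\<And>b. b \<in> boxes ?lam \<Longrightarrow> snd b \<in> Al (w b)"
      using that by (auto simp: placements_def)
    have "inv w (t, Suc j) \<in> boxes ?lam"
      using permutes_in_image[OF permutes_inv[OF w(1)]] tb by blast
    from w(2)[OF this] show ?thesis
      using permutes_inverses[OF w(1)] by simp
  qed
  have "w \<in> ?A \<union> ?B" if "w \<in> ?C" for w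
  proof -
    have w: "w permutes boxes ?lam" "\<And>b. b \<in> boxes ?lam \<Longrightarrow> snd b \<in> exchange_cols j T {t} (w b)"
      using that by (auto simp: placements_def)
    have b: "b = inv w (t, Suc j)" if "w b = (t, Suc j)" for b
      using that permutes_inverses[OF w(1)] by metis
    have "snd (inv w (t, Suc j)) \<in> {j, Suc j}"
      using at[OF that] by (simp add: exchange_cols_def)
    then show ?thesis
    proof
      assume s: "snd (inv w (t, Suc j)) = j"
      have "snd b \<in> exchange_cols j (insert t T) {} (w b)" if "b \<in> boxes ?lam" for b
        using w(2)[OF that] b[of b] s
        by (cases "w b = (t, Suc j)") (auto simp: exchange_cols_def prod_eq_iff split: if_splits)
      then show ?thesis
        using w(1) by (simp add: placements_def)
    next
      assume s: "snd (inv w (t, Suc j)) \<in> {Suc j}"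
      have "snd b \<in> exchange_cols j T {} (w b)" if "b \<in> boxes ?lam" for b
        using w(2)[OF that] b[of b] s t(2)
        by (cases "w b = (t, Suc j)") (auto simp: exchange_cols_def prod_eq_iff split: if_splits)
      then show ?thesis
        using w(1) by (simp add: placements_def)
    qed
  qed
  moreover have "exchange_cols j (insert t T) {} b \<subseteq> exchange_cols j T {t} b"
    "exchange_cols j T {} b \<subseteq> exchange_cols j T {t} b" for b
    using t(2) by (auto simp: exchange_cols_def)
  then have "?A \<subseteq> ?C" "?B \<subseteq> ?C"
    unfolding placements_def by blast+
  ultimately have "?C = ?A \<union> ?B"
    by blast
  moreover have "?A \<inter> ?B = {}"
    using at[of _ "exchange_cols j (insert t T) {}"] at[of _ "exchange_cols j T {}"] t(2)
    by (fastforce simp: exchange_cols_def)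
  ultimately have "signed_count F S (exchange_cols j T {t}) =
      signed_count F S (exchange_cols j (insert t T) {}) + signed_count F S (exchange_cols j T {})"
    by (simp only: signed_count_def sum.union_disjoint finite_placements)
  then show ?thesis
    using signed_count_free_eq_0[OF part j t(1)] by simp
qed

lemma signed_count_exchange_cols:
  assumes "is_partition (shape F)" "1 \<le> j" "Suc j \<le> num_cols (shape F)"
    and "m \<le> col_len (shape F) (Suc j)"
  shows "signed_count F S (exchange_cols j {1..m} {}) =
         (-1) ^ m * signed_count F S (exchange_cols j {} {})"
  using assms(4)
proof (induction m)
  case (Suc m)
  have "{1..Suc m} = insert (Suc m) {1..m}" by auto
  then show ?case
    using Suc signed_count_insert[OF assms(1-3), of "Suc m" "{1..m}" S] by simp
qed simp

section \<open>Exchanges as permutations of boxes\<close>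

definition exchange_perm :: "nat \<Rightarrow> nat set \<Rightarrow> nat \<times> nat \<Rightarrow> nat \<times> nat" where
  "exchange_perm j B = (\<lambda>(r, c).
     if c = j \<and> r \<in> B then (card {b \<in> B. b \<le> r}, Suc j)
     else if c = Suc j \<and> r \<in> {1..card B} then (sorted_list_of_set B ! (r - 1), j)
     else (r, c))"

lemma exchange_eq_rearrange:
  assumes "is_partition (shape E)"
  shows "exchange E j B = rearrange E (exchange_perm j B)"
  unfolding exchange_def rearrange_def
  by (rule mk_filling_cong[OF assms]) (auto simp: exchange_perm_def box_entry_def boxes_def)

text \<open>A new maximum changes no rank in \<open>B\<close> and is appended to the sorted list, so
  the only new pair is \<open>(b, j)\<close> with \<open>(Suc (card B), Suc j)\<close>.\<close>

lemma exchange_perm_insert_max: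
  assumes B: "finite B" and b: "\<And>x. x \<in> B \<Longrightarrow> x < b"
  shows "exchange_perm j (insert b B) =
         exchange_perm j B \<circ> Transposition.transpose (b, j) (Suc (card B), Suc j)"
proof -
  have nb: "b \<notin> B"
    using b by blast
  have card: "card (insert b B) = Suc (card B)"
    using B nb by simp
  have "sorted (sorted_list_of_set B @ [b])" "distinct (sorted_list_of_set B @ [b])"
    "set (sorted_list_of_set B @ [b]) = insert b B"
    using B b nb by (auto simp: sorted_append intro: less_imp_le)
  then have list: "sorted_list_of_set (insert b B) = sorted_list_of_set B @ [b]"
    by (metis sorted_list_of_set.idem_if_sorted_distinct)
  have cut: "{x. (x = b \<or> x \<in> B) \<and> x \<le> r} = {x \<in> B. x \<le> r}" if "r \<in> B" for r
    using b[OF that] by auto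
  have cut_b: "{x. (x = b \<or> x \<in> B) \<and> x \<le> b} = insert b B"
    using b by (auto intro: less_imp_le)
  show ?thesis
  proof
    fix y :: "nat \<times> nat"
    obtain r c where y: "y = (r, c)" by fastforce
    \<comment> \<open>The two boxes of the new pair, the two sides of the old pairs, and the fixed
      boxes.\<close>
    consider "y = (b, j)" | "y = (Suc (card B), Suc j)" | "c = j" "r \<in> B"
      | "c = Suc j" "r \<in> {1..card B}"
      | "\<not> (c = j \<and> r \<in> insert b B)" "\<not> (c = Suc j \<and> r \<in> {1..Suc (card B)})"
      using y by fastforce
    then show "exchange_perm j (insert b B) y =
        (exchange_perm j B \<circ> Transposition.transpose (b, j) (Suc (card B), Suc j)) y"
    proof cases
      case 1
      then show ?thesis
        using cut_b card by (simp add: exchange_perm_def)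
    next
      case 2
      then show ?thesis
        using nb card list by (simp add: exchange_perm_def nth_append)
    next
      case 3
      then have "r \<noteq> b" using nb by blast
      then show ?thesis
        using 3 y cut by (simp add: exchange_perm_def transpose_def)
    next
      case 4
      then show ?thesis
        using y card list by (auto simp: exchange_perm_def transpose_def nth_append)
    next
      case 5
      then show ?thesis
        using y card by (auto simp: exchange_perm_def transpose_def)
    qed
  qed
qed

text \<open>The rank of \<open>r\<close> in \<open>B\<close> and the entry of the sorted list at
  that rank are mutually inverse, so the map is a product of \<open>card B\<close> disjoint
  transpositions. Adding rows in increasing order produces them one by one.\<close>

lemma exchange_perm_permutes_sign:
  assumes "finite B"
  shows "exchange_perm j B permutes B \<times> {j} \<union> {1..card B} \<times> {Suc j} \<and>
         sign (exchange_perm j B) = (-1) ^ card B \<and>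
         (\<forall>y. exchange_perm j B (exchange_perm j B y) = y)"
  using assms
proof (induction B rule: finite_linorder_max_induct)
  case empty
  have eq: "exchange_perm j {} = id"
    by (auto simp: exchange_perm_def)
  show ?case
    unfolding eq by (simp only: permutes_id sign_id card.empty power_0) simp
next
  case (insert b B)
  let ?P = "\<lambda>B. B \<times> {j} \<union> {1..card B} \<times> {Suc j}"
  let ?e = "exchange_perm j B"
  let ?t = "Transposition.transpose (b, j) (Suc (card B), Suc j)"
  have nb: "b \<notin> B"
    using insert by blast
  have IH: "?e permutes ?P B" "sign ?e = (-1) ^ card B" "?e (?e y) = y" for y
    using insert.IH by blast+
  have eq: "exchange_perm j (insert b B) = ?e \<circ> ?t"
    using insert by (intro exchange_perm_insert_max) auto
  have sub: "?P B \<subseteq> ?P (insert b B)"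
    using insert(1) nb by auto
  have "?t permutes ?P (insert b B)"
    using insert(1) nb by (intro permutes_swap_id) auto
  then have "?e \<circ> ?t permutes ?P (insert b B)"
    using permutes_subset[OF IH(1) sub] by (intro permutes_compose)
  moreover have "permutation ?e"
    using IH(1) insert(1) by (intro permutes_imp_permutation[OF _ IH(1)]) auto
  then have "sign (?e \<circ> ?t) = (-1) ^ card (insert b B)"
    using insert(1) nb by (simp only: sign_compose permutation_swap_id sign_swap_id IH(2)) simp
  moreover have "(?e \<circ> ?t) ((?e \<circ> ?t) y) = y" for y
  proof -
    have fixed: "?e (b, j) = (b, j)" "?e (Suc (card B), Suc j) = (Suc (card B), Suc j)"
      using nb by (auto simp: exchange_perm_def)
    have inj: "inj ?e"
      using permutes_inj[OF IH(1)] .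
    \<comment> \<open>\<open>?e\<close> fixes both boxes moved by \<open>?t\<close>, so these two
      involutions commute and their composition is again an involution.\<close>
    have "?t (?e x) = ?e (?t x)" for x
      using fixed inj_eq[OF inj, of x "(b, j)"] inj_eq[OF inj, of x "(Suc (card B), Suc j)"]
      by (auto simp: transpose_def)
    then show ?thesis
      using IH(3) by simp
  qed
  ultimately show ?case
    unfolding eq by blast
qed

lemma exchange_perm_idem: "finite B \<Longrightarrow> exchange_perm j B (exchange_perm j B y) = y"
  using exchange_perm_permutes_sign[of B j] by blast

lemma exchange_perm_cols: "snd (exchange_perm j B y) \<in> exchange_cols j {1..card B} {} y"
  by (auto simp: exchange_perm_def exchange_cols_def split: prod.splits)

lemma exchange_perm_mem_iff:
  "snd y = j \<Longrightarrow> snd (exchange_perm j B y) = Suc j \<longleftrightarrow> fst y \<in> B"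
  by (cases y) (auto simp: exchange_perm_def)

lemma exchange_perm_permutes_boxes:
  assumes "1 \<le> j" "Suc j \<le> num_cols lam"
    and "B \<subseteq> {1..col_len lam j}" "card B \<le> col_len lam (Suc j)"
  shows "exchange_perm j B permutes boxes lam"
proof (rule permutes_subset)
  have "finite B"
    using assms(3) finite_subset by blast
  then show "exchange_perm j B permutes B \<times> {j} \<union> {1..card B} \<times> {Suc j}"
    using exchange_perm_permutes_sign by blast
qed (use assms in \<open>auto simp: boxes_def\<close>)

text \<open>A choice \<open>B\<close> and a column-preserving placement \<open>w\<close> combine to
  \<open>h = exchange_perm j B \<circ> w\<close>, with \<open>sign h = (-1) ^ m * sign w\<close>.
  This is a bijection, since \<open>B\<close> can be recovered from \<open>h\<close>.\<close>

lemma sum_rearr_exchange_eq_signed_count: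
  assumes part: "is_partition (shape E)" and j: "1 \<le> j" "Suc j \<le> num_cols (shape E)"
    and m: "m \<le> col_len (shape E) (Suc j)"
  shows "(\<Sum>B \<in> {B. B \<subseteq> {1..col_len (shape E) j} \<and> card B = m}. rearr (exchange E j B) S) =
         (-1) ^ m * signed_count E S (exchange_cols j {1..m} {})"
proof -
  let ?lam = "shape E"
  let ?P = "placements ?lam (\<lambda>b. {snd b})"
  let ?Q = "placements ?lam (exchange_cols j {1..m} {})"
  let ?e = "exchange_perm j"
  define p where "p = col_len ?lam j"
  define q where "q = col_len ?lam (Suc j)"
  define \<B> where "\<B> = {B. B \<subseteq> {1..p} \<and> card B = m}"
  \<comment> \<open>The rows of column \<open>j\<close> whose boxes \<open>h\<close> places in
    column \<open>j + 1\<close>; this is how \<open>B\<close> is recovered.\<close>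
  define moved where "moved h = {r \<in> {1..p}. \<exists>s. h (s, Suc j) = (r, j)}"
    for h :: "nat \<times> nat \<Rightarrow> nat \<times> nat"
  define g where "g h = sign h * of_bool (same_row_content (rearrange E h) S)" for h
  have finB: "finite B" if "B \<in> \<B>" for B
    using that finite_subset by (auto simp: \<B>_def)
  have eperm: "?e B permutes boxes ?lam" if "B \<in> \<B>" for B
    using that j m by (intro exchange_perm_permutes_boxes) (auto simp: \<B>_def p_def)
  have summand: "rearr (exchange E j B) S = (\<Sum>w\<in>?P. (-1) ^ m * g (?e B \<circ> w))" if B: "B \<in> \<B>" for B
  proof -
    have "rearr (exchange E j B) S =
        (\<Sum>w\<in>?P. sign w * of_bool (same_row_content (rearrange (rearrange E (?e B)) w) S))"
      using part by (simp only: exchange_eq_rearrange rearr_eq_signed_count shape_rearrange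
          signed_count_def)
    also have "\<dots> = (\<Sum>w\<in>?P. (-1) ^ m * g (?e B \<circ> w))"
    proof (rule sum.cong[OF refl])
      fix w assume w: "w \<in> ?P"
      have "w permutes boxes ?lam"
        using w by (simp add: placements_def)
      then have "rearrange (rearrange E (?e B)) w = rearrange E (?e B \<circ> w)"
        using part by (intro rearrange_rearrange)
      moreover have "sign (?e B \<circ> w) = (-1) ^ m * sign w"
        using exchange_perm_permutes_sign[OF finB[OF B], of j] B
          permutes_imp_permutation[OF finite_boxes eperm[OF B]] permutation_placement[OF w]
        by (simp only: sign_compose) (simp add: \<B>_def)
      ultimately show "sign w * of_bool (same_row_content (rearrange (rearrange E (?e B)) w) S) =
          (-1) ^ m * g (?e B \<circ> w)"
        by (simp only: g_def) (simp flip: mult.assoc power_add)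
    qed
    finally show ?thesis .
  qed
  have "finite \<B>"
    unfolding \<B>_def by (rule finite_subset[of _ "Pow {1..p}"]) auto
  have "(\<Sum>B\<in>\<B>. rearr (exchange E j B) S) = (\<Sum>B\<in>\<B>. \<Sum>w\<in>?P. (-1) ^ m * g (?e B \<circ> w))"
    using summand by (intro sum.cong) auto
  also have "\<dots> = (\<Sum>(B, w)\<in>\<B> \<times> ?P. (-1) ^ m * g (?e B \<circ> w))"
    by (rule sum.cartesian_product)
  also have "\<dots> = (\<Sum>h\<in>?Q. (-1) ^ m * g h)"
  proof (rule sum.reindex_bij_witness[where i = "\<lambda>h. (moved h, ?e (moved h) \<circ> h)"
        and j = "\<lambda>(B, w). ?e B \<circ> w"], goal_cases)
    case (1 Bw)
    then obtain B w where Bw: "Bw = (B, w)" "B \<in> \<B>" "w \<in> ?P" by blast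
    have w: "w permutes boxes ?lam" "\<And>b. b \<in> boxes ?lam \<Longrightarrow> snd b = snd (w b)"
      using Bw(3) by (auto simp: placements_def)
    note idem = exchange_perm_idem[OF finB[OF Bw(2)]]
    \<comment> \<open>As \<open>w\<close> keeps columns and \<open>?e B\<close> is its own inverse,
      box \<open>(r, j)\<close> lands in column \<open>j + 1\<close> exactly if \<open>?e B\<close>
      sends it there, that is, if \<open>r\<close> is in \<open>B\<close>.\<close>
    have "moved (?e B \<circ> w) = B"
    proof (intro set_eqI iffI)
      fix r assume "r \<in> moved (?e B \<circ> w)"
      then obtain s where r: "r \<in> {1..p}" "?e B (w (s, Suc j)) = (r, j)"
        by (auto simp: moved_def)
      then have eq: "w (s, Suc j) = ?e B (r, j)"
        using idem by metis
      have "(r, j) \<in> boxes ?lam"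
        using r(1) j by (auto simp: boxes_def p_def)
      then have "w (s, Suc j) \<in> boxes ?lam"
        unfolding eq using permutes_in_image[OF eperm[OF Bw(2)]] by blast
      then have "(s, Suc j) \<in> boxes ?lam"
        using permutes_in_image[OF w(1)] by blast
      from w(2)[OF this] show "r \<in> B"
        unfolding eq using exchange_perm_mem_iff[of "(r, j)" j B] by simp
    next
      fix r assume r: "r \<in> B"
      then have rp: "r \<in> {1..p}"
        using Bw(2) by (auto simp: \<B>_def)
      define b where "b = inv w (?e B (r, j))"
      have wb: "w b = ?e B (r, j)"
        using permutes_inverses[OF w(1)] by (simp add: b_def)
      have "(r, j) \<in> boxes ?lam"
        using rp j by (auto simp: boxes_def p_def)
      then have "b \<in> boxes ?lam"
        using permutes_in_image[OF eperm[OF Bw(2)]] permutes_in_image[OF w(1)] wb by metis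
      then have "snd b = Suc j"
        using w(2)[of b] exchange_perm_mem_iff[of "(r, j)" j B] r by (simp add: wb)
      then have "(?e B \<circ> w) (fst b, Suc j) = (r, j)"
        using wb idem by (cases b) auto
      then show "r \<in> moved (?e B \<circ> w)"
        using rp unfolding moved_def by blast
    qed
    then show ?case
      using idem by (simp add: Bw(1) fun_eq_iff)
  next
    case (2 Bw)
    then obtain B w where Bw: "Bw = (B, w)" "B \<in> \<B>" "w \<in> ?P" by blast
    have w: "w permutes boxes ?lam" "\<And>b. b \<in> boxes ?lam \<Longrightarrow> snd b = snd (w b)"
      using Bw(3) by (auto simp: placements_def)
    have "snd b \<in> exchange_cols j {1..m} {} (?e B (w b))" if "b \<in> boxes ?lam" for b
      using exchange_perm_cols[of j B "?e B (w b)"] w(2)[OF that] Bw(2)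
        exchange_perm_idem[OF finB[OF Bw(2)], of j "w b"] by (simp add: \<B>_def)
    then show ?case
      using permutes_compose[OF w(1) eperm[OF Bw(2)]] by (simp add: Bw(1) placements_def)
  next
    case (3 h)
    have "finite (moved h)"
      by (simp add: moved_def)
    then show ?case
      using exchange_perm_idem by (auto simp: fun_eq_iff)
  next
    case (4 h)
    then have h: "h permutes boxes ?lam"
        "\<And>b. b \<in> boxes ?lam \<Longrightarrow> snd b \<in> exchange_cols j {1..m} {} (h b)"
      by (auto simp: placements_def)
    have hbox: "h b \<in> boxes ?lam \<longleftrightarrow> b \<in> boxes ?lam" for b
      using permutes_in_image[OF h(1)] .
    have boxj: "(r, j) \<in> boxes ?lam \<longleftrightarrow> r \<in> {1..p}" "(r, Suc j) \<in> boxes ?lam \<longleftrightarrow> r \<in> {1..q}" for r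
      using j by (auto simp: boxes_def p_def q_def)
    \<comment> \<open>Counting the boxes that fill column \<open>j + 1\<close>: \<open>q - m\<close>
      stay there and the others come from column \<open>j\<close>, so \<open>moved h\<close> has
      \<open>m\<close> elements.\<close>
    have "h ` ({1..q} \<times> {Suc j}) = {Suc m..q} \<times> {Suc j} \<union> moved h \<times> {j}"
    proof (intro set_eqI iffI)
      fix y assume "y \<in> h ` ({1..q} \<times> {Suc j})"
      then obtain s where s: "s \<in> {1..q}" "y = h (s, Suc j)" by auto
      obtain r c where y: "y = (r, c)" by fastforce
      have "(r, c) \<in> boxes ?lam" "Suc j \<in> exchange_cols j {1..m} {} (r, c)"
        using hbox[of "(s, Suc j)"] boxj s h(2)[of "(s, Suc j)"] by (auto simp flip: y)
      moreover have "h (s, Suc j) = (r, c)"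
        using s(2) y by simp
      ultimately show "y \<in> {Suc m..q} \<times> {Suc j} \<union> moved h \<times> {j}"
        unfolding y using boxj by (auto simp: exchange_cols_def moved_def split: if_splits)
    next
      fix y assume y: "y \<in> {Suc m..q} \<times> {Suc j} \<union> moved h \<times> {j}"
      then have yb: "y \<in> boxes ?lam"
        using boxj by (auto simp: moved_def)
      define b where "b = inv h y"
      have hb: "h b = y"
        using permutes_inverses[OF h(1)] by (simp add: b_def)
      have bb: "b \<in> boxes ?lam"
        using hbox[of b] yb by (simp add: hb)
      have "snd b = Suc j"
      proof (cases "snd y = Suc j")
        case True
        then show ?thesis
          using h(2)[OF bb] y by (auto simp: hb exchange_cols_def)
      next
        case False
        then obtain s where "h (s, Suc j) = y"
          using y by (auto simp: moved_def)
        then have "b = (s, Suc j)"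
          using permutes_inverses[OF h(1)] by (metis b_def)
        then show ?thesis by simp
      qed
      then show "y \<in> h ` ({1..q} \<times> {Suc j})"
        using hb bb boxj by (cases b) (auto intro!: image_eqI[of _ _ b])
    qed
    moreover have "card (h ` ({1..q} \<times> {Suc j})) = q"
      using card_image[OF inj_on_subset[OF permutes_inj[OF h(1)]], of "{1..q} \<times> {Suc j}"] by simp
    moreover have "card ({Suc m..q} \<times> {Suc j} \<union> moved h \<times> {j}) = (q - m) + card (moved h)"
      by (subst card_Un_disjoint) (auto simp: moved_def card_cartesian_product)
    ultimately have "card (moved h) = m"
      using m by (simp add: q_def)
    then have B: "moved h \<in> \<B>"
      by (auto simp: \<B>_def moved_def)
    \<comment> \<open>\<open>?e (moved h)\<close> undoes every change of column: in column
      \<open>j\<close> the boxes that leave are those in \<open>moved h\<close>, and in column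
      \<open>j + 1\<close> they are the top \<open>m\<close>, which is the size of
      \<open>moved h\<close>.\<close>
    have "snd b = snd (?e (moved h) (h b))" if b: "b \<in> boxes ?lam" for b
    proof -
      have hb: "h b \<in> boxes ?lam"
        using hbox b by blast
      have *: "snd b \<in> exchange_cols j {1..m} {} (h b)"
        by (rule h(2)[OF b])
      show ?thesis
      proof (cases "snd (h b) = j")
        case True
        then have "fst (h b) \<in> {1..p}"
          using hb boxj by (metis prod.collapse)
        moreover have "b = (s, Suc j)" if "h (s, Suc j) = h b" for s
          using permutes_inj[OF h(1)] that by (auto dest: injD)
        ultimately have "fst (h b) \<in> moved h \<longleftrightarrow> snd b = Suc j"
          using True unfolding moved_def
          by (cases b; cases "h b") auto
        then show ?thesis
          using * True
          by (cases "h b") (auto simp: exchange_cols_def exchange_perm_def split: if_splits)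
      next
        case False
        then show ?thesis
          using * hb \<open>card (moved h) = m\<close>
          by (cases "h b") (auto simp: exchange_cols_def exchange_perm_def split: if_splits)
      qed
    qed
    then have "?e (moved h) \<circ> h \<in> ?P"
      using permutes_compose[OF h(1) eperm[OF B]] by (simp add: placements_def)
    then show ?case
      using B by simp
  next
    case (5 Bw)
    then show ?case
      by (cases Bw) simp
  qed
  also have "\<dots> = (-1) ^ m * signed_count E S (exchange_cols j {1..m} {})"
    by (simp only: signed_count_def g_def sum_distrib_left)
  finally show ?thesis
    by (simp only: \<B>_def p_def)
qed

lemma rearr_exchange:
  assumes part: "is_partition (shape E)" and j: "1 \<le> j" "Suc j \<le> num_cols (shape E)"
    and m: "m \<le> col_len (shape E) (Suc j)"
  shows "(\<Sum>B \<in> {B. B \<subseteq> {1..col_len (shape E) j} \<and> card B = m}. rearr (exchange E j B) S) =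
         rearr E S"
proof -
  \<comment> \<open>The case \<open>m = 0\<close> identifies the count with nothing forced to move
    as \<open>rearr E S\<close>: column \<open>j + 1\<close> is full of its own boxes, so column
    \<open>j\<close> keeps its own too.\<close>
  have "{B. B \<subseteq> {1..col_len (shape E) j} \<and> card B = 0} = {{}}"
    by (auto dest: finite_subset)
  moreover have "exchange_perm j {} = id"
    by (auto simp: exchange_perm_def)
  ultimately have "rearr E S = signed_count E S (exchange_cols j {} {})"
    using sum_rearr_exchange_eq_signed_count[OF part j, of 0 S]
    by (simp add: exchange_eq_rearrange part rearrange_id)
  then show ?thesis
    using sum_rearr_exchange_eq_signed_count[OF part j m] signed_count_exchange_cols[OF part j m]
    by (simp flip: mult.assoc power_add)
qed

section \<open>Triangularity\<close>

text \<open>If \<open>v = ys ! i\<close> were below \<open>xs ! i\<close>, then at least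
  \<open>i + 1\<close> entries of \<open>ys\<close>, hence of \<open>zs\<close>, would be at most
  \<open>v\<close>. But from position \<open>i\<close> on, \<open>zs\<close> dominates
  \<open>xs\<close>, which is sorted and already above \<open>v\<close>, leaving at most
  \<open>i\<close>.\<close>

lemma sorted_nth_le_of_mset_eq:
  fixes xs ys zs :: "'a :: linorder list"
  assumes "sorted xs" "sorted ys" "mset zs = mset ys" "length xs = length ys"
    and le: "\<And>k. k < length xs \<Longrightarrow> xs ! k \<le> zs ! k" and i: "i < length xs"
  shows "xs ! i \<le> ys ! i"
proof (rule ccontr)
  assume less: "\<not> xs ! i \<le> ys ! i"
  let ?v = "ys ! i"
  have len: "length zs = length ys"
    using assms(3) by (metis size_mset)
  have "{..i} \<subseteq> {k. k < length ys \<and> ys ! k \<le> ?v}"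
    using assms(2,4) i by (auto intro: sorted_nth_mono)
  from card_mono[OF _ this] have "Suc i \<le> length (filter (\<lambda>y. y \<le> ?v) ys)"
    by (simp add: length_filter_conv_card)
  also have "length (filter (\<lambda>y. y \<le> ?v) ys) = length (filter (\<lambda>y. y \<le> ?v) zs)"
    using assms(3) by (metis mset_filter size_mset)
  also have "\<dots> = card {k. k < length zs \<and> zs ! k \<le> ?v}"
    by (simp add: length_filter_conv_card)
  also have "\<dots> \<le> card {..<i}"
  proof (rule card_mono)
    show "{k. k < length zs \<and> zs ! k \<le> ?v} \<subseteq> {..<i}"
    proof
      fix k assume k: "k \<in> {k. k < length zs \<and> zs ! k \<le> ?v}"
      show "k \<in> {..<i}"
      proof (rule ccontr)
        assume "k \<notin> {..<i}"
        then have "xs ! i \<le> xs ! k"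
          using assms(1,4) k len by (auto intro: sorted_nth_mono)
        also have "\<dots> \<le> zs ! k"
          using le k len assms(4) by auto
        also have "\<dots> \<le> ?v"
          using k by simp
        finally show False
          using less by simp
      qed
    qed
  qed simp
  finally show False
    by simp
qed

text \<open>Equal row lengths align the row boundaries, so the comparison is decided inside the
  first row that differs.\<close>

lemma lexord_concat_same_shape:
  assumes "(concat B, concat A) \<in> lexord R" "map length A = map length B"
    and irrefl: "\<And>x. (x, x) \<notin> R"
  shows "\<exists>i < length A. (B ! i, A ! i) \<in> lexord R \<and> (\<forall>k < i. B ! k = A ! k)"
  using map_eq_imp_length_eq[OF assms(2)] assms(1,2)
proof (induction A B rule: list_induct2)
  case Nil
  then show ?case by simp
next
  case (Cons a A b B)
  have len: "length (concat B) = length (concat A)"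
    using Cons.prems(2) by (simp add: length_concat)
  show ?case
  proof (cases "b = a")
    case True
    then have "(concat B, concat A) \<in> lexord R"
      using Cons.prems(1) irrefl by (auto dest: lexord_append_leftD)
    then obtain i where "i < length A" "(B ! i, A ! i) \<in> lexord R" "\<forall>k < i. B ! k = A ! k"
      using Cons by auto
    then show ?thesis
      using True by (intro exI[of _ "Suc i"]) (auto simp: nth_Cons split: nat.splits)
  next
    case False
    then have "(b, a) \<in> lexord R"
      using Cons.prems lexord_sufE[of b "concat B" a "concat A" R] len by simp
    then show ?thesis
      by (intro exI[of _ 0]) auto
  qed
qed

text \<open>One placement \<open>w\<close> contributing to \<open>rearr E T\<close>. Its existence
  will exclude \<open>T \<prec> E\<close>, and \<open>T = E\<close> will force
  \<open>w = id\<close>.\<close>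

locale rearranged_tableaux =
  fixes E T :: filling and w :: "nat \<times> nat \<Rightarrow> nat \<times> nat"
  assumes part: "is_partition (shape E)" and sh: "shape T = shape E"
    and ss: "semistandard E" "semistandard T"
    and w: "w \<in> placements (shape E) (\<lambda>b. {snd b})"
    and same: "same_row_content (rearrange E w) T"
begin

lemma w_permutes: "w permutes boxes (shape E)"
  and snd_w: "b \<in> boxes (shape E) \<Longrightarrow> snd (w b) = snd b"
  using w by (auto simp: placements_def)

lemma row_in_set:
  assumes "shape F = shape E" "r \<in> {1..length (shape E)}"
  shows "F ! (r - 1) \<in> set F"
  using assms map_eq_imp_length_eq[of length F length E] by (auto simp: shape_def intro!: nth_mem)

lemma length_row:
  assumes "shape F = shape E" "r \<in> {1..length (shape E)}"
  shows "length (F ! (r - 1)) = shape E ! (r - 1)"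
proof -
  have "r - 1 < length F"
    using assms map_eq_imp_length_eq[of length F length E] by (auto simp: shape_def)
  then show ?thesis
    unfolding assms(1)[symmetric] by (simp add: shape_def)
qed

text \<open>Row \<open>r\<close> is the first row that \<open>w\<close> may change.\<close>

context
  fixes r assumes r: "r \<in> {1..length (shape E)}"
    and fix_above: "\<And>s c. s < r \<Longrightarrow> w (s, c) = (s, c)"
begin

text \<open>The boxes above row \<open>r\<close> are already used at their own positions, so
  \<open>w (r, c)\<close> lies in row \<open>r\<close> or below in column \<open>c\<close>, and
  columns of \<open>E\<close> strictly increase.\<close>

lemma entry_le:
  assumes "(r, c) \<in> boxes (shape E)"
  shows "entry E r c \<le> box_entry E (w (r, c))"
    and "entry E r c = box_entry E (w (r, c)) \<Longrightarrow> w (r, c) = (r, c)"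
proof -
  have s: "w (r, c) = (fst (w (r, c)), c)"
    using snd_w[OF assms] by (simp add: prod_eq_iff)
  define s where "s = fst (w (r, c))"
  note s = s[folded s_def]
  have "r \<le> s"
  proof (rule ccontr)
    assume "\<not> r \<le> s"
    then have "w (s, c) = w (r, c)"
      using fix_above[of s c] s by simp
    then show False
      using injD[OF permutes_inj[OF w_permutes]] \<open>\<not> r \<le> s\<close> by blast
  qed
  have "(s, c) \<in> boxes (shape E)"
    using permutes_in_image[OF w_permutes, of "(r, c)"] assms by (simp add: s)
  then have "r \<in> {1..col_len (shape E) c}" "s \<in> {1..col_len (shape E) c}"
    using assms by (simp_all add: boxes_def)
  moreover have "strict_mono_on {1..col_len (shape E) c} (\<lambda>r. entry E r c)"
    using ss(1) assms by (auto simp: semistandard_def tableau_def boxes_def)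
  ultimately have "r = s \<or> entry E r c < entry E s c"
    using \<open>r \<le> s\<close> strict_mono_onD[of _ "\<lambda>r. entry E r c" r s] by fastforce
  then show "entry E r c \<le> box_entry E (w (r, c))"
    and "entry E r c = box_entry E (w (r, c)) \<Longrightarrow> w (r, c) = (r, c)"
    using s by (auto simp: box_entry_def)
qed

lemma nth_rearrange_row:
  "k < shape E ! (r - 1) \<Longrightarrow> rearrange E w ! (r - 1) ! k = box_entry E (w (r, Suc k))"
  by (subst nth_rearrange[OF r]) (simp del: upt_Suc)

lemma length_rearrange_row: "length (rearrange E w ! (r - 1)) = shape E ! (r - 1)"
  by (subst nth_rearrange[OF r]) (simp del: upt_Suc)

lemma mset_row: "mset (rearrange E w ! (r - 1)) = mset (T ! (r - 1))"
proof -
  have "shape (rearrange E w) = shape T"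
    using sh by simp
  from same[unfolded same_row_content_iff[OF this]] show ?thesis
    using r unfolding sh by blast
qed

lemma box_row: "k < shape E ! (r - 1) \<Longrightarrow> (r, Suc k) \<in> boxes (shape E)"
  using r by (auto simp: boxes_iff part)

text \<open>The rearranged row dominates row \<open>r\<close> of \<open>E\<close> entrywise, and row
  \<open>r\<close> of \<open>T\<close> is its sorted version.\<close>

lemma row_nth_le:
  assumes "k < shape E ! (r - 1)"
  shows "E ! (r - 1) ! k \<le> T ! (r - 1) ! k"
proof (rule sorted_nth_le_of_mset_eq)
  show "sorted (E ! (r - 1))" "sorted (T ! (r - 1))"
    using ss row_in_set[OF refl r] row_in_set[OF sh r] by (auto simp: semistandard_def)
  show "mset (rearrange E w ! (r - 1)) = mset (T ! (r - 1))"
    by (rule mset_row)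
  show "E ! (r - 1) ! i \<le> rearrange E w ! (r - 1) ! i" if "i < length (E ! (r - 1))" for i
    using entry_le(1)[OF box_row[of i]] that nth_rearrange_row[of i] length_row[OF refl r]
    by (simp add: entry_def)
  show "length (E ! (r - 1)) = length (T ! (r - 1))"
    by (simp only: length_row[OF refl r] length_row[OF sh r])
  show "k < length (E ! (r - 1))"
    using assms by (simp only: length_row[OF refl r])
qed

text \<open>The rearranged row dominates that of \<open>E\<close> entrywise and has the same sum, so
  the two rows agree; equality of entries then fixes each box.\<close>

lemma fix_row:
  assumes eq: "T ! (r - 1) = E ! (r - 1)"
  shows "w (r, c) = (r, c)"
proof (cases "(r, c) \<in> boxes (shape E)")
  case False
  then show ?thesis
    by (rule permutes_not_in[OF w_permutes])
next
  case True
  let ?l = "shape E ! (r - 1)"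
  have "mset (rearrange E w ! (r - 1)) = mset (E ! (r - 1))"
    using mset_row by (simp only: eq)
  then have "sum_list (rearrange E w ! (r - 1)) = sum_list (E ! (r - 1))"
    by (metis sum_mset_sum_list)
  then have sum: "(\<Sum>k<?l. rearrange E w ! (r - 1) ! k) = (\<Sum>k<?l. E ! (r - 1) ! k)"
    using length_row[OF refl r] length_rearrange_row by (simp add: sum_list_sum_nth atLeast0LessThan)
  have le: "E ! (r - 1) ! k \<le> rearrange E w ! (r - 1) ! k" if "k < ?l" for k
    using entry_le(1)[OF box_row[OF that]] nth_rearrange_row[OF that] by (simp add: entry_def)
  have c: "c - 1 < ?l" "Suc (c - 1) = c"
    using True by (auto simp: boxes_iff part)
  have "\<not> E ! (r - 1) ! (c - 1) < rearrange E w ! (r - 1) ! (c - 1)"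
  proof
    assume "E ! (r - 1) ! (c - 1) < rearrange E w ! (r - 1) ! (c - 1)"
    then have "(\<Sum>k<?l. E ! (r - 1) ! k) < (\<Sum>k<?l. rearrange E w ! (r - 1) ! k)"
      using le c(1) by (intro sum_strict_mono_ex1) auto
    then show False
      using sum by simp
  qed
  then have "entry E r c = box_entry E (w (r, c))"
    using le[OF c(1)] nth_rearrange_row[OF c(1)] c(2) by (simp add: entry_def)
  then show ?thesis
    by (rule entry_le(2)[OF True])
qed

end

lemma fix_rows:
  assumes "\<And>k. k < i \<Longrightarrow> T ! k = E ! k" "i \<le> length (shape E)" "r \<le> i"
  shows "w (r, c) = (r, c)"
  using assms(3)
proof (induction r arbitrary: c rule: less_induct)
  case (less r)
  show ?case
  proof (cases "r = 0")
    case True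
    \<comment> \<open>Rows count from 1, so row 0 lies outside the diagram.\<close>
    then show ?thesis
      by (intro permutes_not_in[OF w_permutes]) (simp add: boxes_def)
  next
    case False
    have above: "w (s, d) = (s, d)" if "s < r" for s d
      using less.IH[OF that] less.prems that by simp
    have "r \<in> {1..length (shape E)}"
      using False less.prems assms(2) by simp
    moreover have "T ! (r - 1) = E ! (r - 1)"
      using False less.prems by (intro assms(1)) simp
    ultimately show ?thesis
      using fix_row above by blast
  qed
qed

lemma not_less: "\<not> T \<prec> E"
proof
  assume "T \<prec> E"
  then have "\<exists>i < length E. (T ! i, E ! i) \<in> lexord {(x, y). x < y} \<and> (\<forall>k < i. T ! k = E ! k)"
    using sh by (intro lexord_concat_same_shape) (auto simp: rw_less_def row_word_def shape_def)
  then obtain i where i: "i < length E" "(T ! i, E ! i) \<in> lexord {(x, y). x < y}"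
      "\<And>k. k < i \<Longrightarrow> T ! k = E ! k"
    by auto
  have r: "Suc i \<in> {1..length (shape E)}"
    using i(1) by (simp add: shape_def)
  \<comment> \<open>List index \<open>i\<close> is row \<open>i + 1\<close>, the first row where
    \<open>T\<close> and \<open>E\<close> differ; \<open>w\<close> fixes all rows above it. There
    \<open>T\<close> dominates \<open>E\<close> entrywise, so its row cannot be lexicographically
    smaller.\<close>
  have "w (s, c) = (s, c)" if "s < Suc i" for s c
    using that r by (intro fix_rows[of i]) (auto simp: i(3))
  from row_nth_le[OF r this]
  have le: "E ! i ! k \<le> T ! i ! k" if "k < shape E ! i" for k
    using that by simp
  have "length (E ! i) = shape E ! i" "length (T ! i) = shape E ! i"
    using length_row[OF refl r] length_row[OF sh r] by auto
  then obtain k where "k < shape E ! i" "T ! i ! k < E ! i ! k"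
    using i(2) by (auto simp: lexord_take_index_conv)
  then show False
    using le by fastforce
qed

lemma eq_id:
  assumes "T = E"
  shows "w = id"
proof -
  have "w (r, c) = (r, c)" for r c
  proof (cases "(r, c) \<in> boxes (shape E)")
    case True
    then show ?thesis
      using assms by (intro fix_rows[of "length (shape E)"]) (auto simp: boxes_iff part)
  qed (rule permutes_not_in[OF w_permutes])
  then show ?thesis
    by auto
qed

end

lemma rearr_eq_0_if_less:
  assumes "is_partition (shape E)" "shape T = shape E" "semistandard E" "semistandard T" "T \<prec> E"
  shows "rearr E T = 0"
proof -
  have "\<not> same_row_content (rearrange E w) T" if "w \<in> placements (shape E) (\<lambda>b. {snd b})" for w
    using rearranged_tableaux.not_less[of E T w] assms that by (auto simp: rearranged_tableaux_def)
  then show ?thesis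
    using assms(1) by (simp add: rearr_eq_signed_count signed_count_def)
qed

lemma rearr_self:
  assumes "is_partition (shape E)" "semistandard E"
  shows "rearr E E = 1"
proof -
  let ?P = "placements (shape E) (\<lambda>b. {snd b})"
  have "id \<in> ?P"
    by (simp only: placements_def permutes_id mem_Collect_eq) simp
  moreover have "\<not> same_row_content (rearrange E w) E" if "w \<in> ?P - {id}" for w
    using rearranged_tableaux.eq_id[of E E w] assms that by (auto simp: rearranged_tableaux_def)
  ultimately have "signed_count E E (\<lambda>b. {snd b}) =
      (\<Sum>w\<in>{id}. sign w * of_bool (same_row_content (rearrange E w) E))"
    unfolding signed_count_def by (intro sum.mono_neutral_right) auto
  also have "\<dots> = 1"
    by (simp add: rearrange_id[unfolded id_def] id_def same_row_content_def)
  finally show ?thesis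
    using assms(1) by (simp add: rearr_eq_signed_count)
qed

section \<open>The rearrangement form\<close>

definition rearr_form :: "filling \<Rightarrow> fvec \<Rightarrow> complex" where
  "rearr_form S v = (\<Sum>F \<in> Poly_Mapping.keys v. Poly_Mapping.lookup v F * of_int (rearr F S))"

text \<open>Provides a common index set for vectors with different supports, as linearity
  requires.\<close>

lemma rearr_form_superset:
  assumes "finite A" "Poly_Mapping.keys v \<subseteq> A"
  shows "rearr_form S v = (\<Sum>F \<in> A. Poly_Mapping.lookup v F * of_int (rearr F S))"
  unfolding rearr_form_def using assms by (intro sum.mono_neutral_left) (auto simp: in_keys_iff)

lemma rearr_form_vec [simp]: "rearr_form S (vec F) = of_int (rearr F S)"
  by (simp add: rearr_form_def vec_def)

lemma rearr_form_add: "rearr_form S (v + u) = rearr_form S v + rearr_form S u"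
  using rearr_form_superset[of "Poly_Mapping.keys v \<union> Poly_Mapping.keys u"]
    Poly_Mapping.keys_add[of v u]
  by (simp add: lookup_add algebra_simps sum.distrib)

lemma rearr_form_scale: "rearr_form S (k \<cdot> v) = k * rearr_form S v"
proof -
  have "Poly_Mapping.keys (k \<cdot> v) \<subseteq> Poly_Mapping.keys v"
    by (auto simp: in_keys_iff lookup_scale)
  then show ?thesis
    using rearr_form_superset[of "Poly_Mapping.keys v" "k \<cdot> v"]
    by (simp add: rearr_form_def lookup_scale sum_distrib_left mult.assoc)
qed

lemma rearr_form_zero: "rearr_form S 0 = 0"
  by (simp add: rearr_form_def)

lemma rearr_form_sum: "rearr_form S (\<Sum>i\<in>I. f i) = (\<Sum>i\<in>I. rearr_form S (f i))"
  by (induction I rule: infinite_finite_induct) (simp_all add: rearr_form_add rearr_form_zero)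

lemma rearr_form_diff: "rearr_form S (v - u) = rearr_form S v - rearr_form S u"
  using rearr_form_add[of S "v - u" u] by simp

text \<open>The kernel of the form is a subspace containing both families of generators, so the form
  descends to the quotient.\<close>

lemma rearr_form_A_all:
  assumes "v \<in> A_all n"
  shows "rearr_form S v = 0"
proof -
  have "fvec.subspace {v. rearr_form S v = 0}"
    by (intro fvec.subspaceI) (auto simp: rearr_form_zero rearr_form_add rearr_form_scale)
  moreover have "transposition_relations n \<subseteq> {v. rearr_form S v = 0}"
    by (auto simp: transposition_relations_def rearr_form_add rearr_swap_in_col all_fillings_def)
  moreover have "exchange_relations n \<subseteq> {v. rearr_form S v = 0}"
    by (auto simp: exchange_relations_def rearr_form_diff rearr_form_sum
        rearr_exchange[unfolded One_nat_def] all_fillings_def simp flip: of_int_sum)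
  ultimately show ?thesis
    using assms fvec.span_minimal[of _ "{v. rearr_form S v = 0}"] unfolding A_all_def by blast
qed

section \<open>Expansion in the D-basis\<close>

theorem theorem4p3:
  fixes n K :: nat and lam z :: "nat list" and S :: "nat \<Rightarrow> filling"
    and F :: filling and a :: "nat \<Rightarrow> complex"
  assumes "n \<ge> 2"
    and "is_partition lam" and "length lam \<le> n"
    and "length z = n" and "sum_list z = sum_list lam"
    and "K = card (ssyt n lam z)"
    and "bij_betw S {1..K} (ssyt n lam z)"
    and "\<And>i j. 1 \<le> i \<Longrightarrow> i < j \<Longrightarrow> j \<le> K \<Longrightarrow> S j \<prec> S i"
    and "F \<in> fillings n lam z"
    and "coset n lam z (vec F) = coset n lam z (\<Sum>i=1..K. a i \<cdot> vec (S i))"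
  shows "coset n lam z (\<Sum>i=1..K. a i \<cdot> vec (S i)) =
         coset n lam z (\<Sum>j=1..K. of_int (rearr F (S j)) \<cdot> D_rep S j)"
proof -
  have S: "shape (S i) = lam" "semistandard (S i)" if "i \<in> {1..K}" for i
    using bij_betwE[OF assms(7)] that by (auto simp: ssyt_def fillings_def)
  have "vec F - (\<Sum>i=1..K. a i \<cdot> vec (S i)) \<in> A_all n"
    using assms(10) unfolding coset_eq_iff A_rel_def by blast
  from rearr_form_A_all[OF this]
  have coeff: "of_int (rearr F T) = (\<Sum>i=1..K. a i * of_int (rearr (S i) T))" for T
    by (simp add: rearr_form_diff rearr_form_sum rearr_form_scale)
  \<comment> \<open>The recursion solved for \<open>vec (S i)\<close>: terms with
    \<open>j > i\<close> vanish because \<open>S j \<prec> S i\<close>, and the diagonal coefficient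
    is 1. This is an identity of representatives.\<close>
  have expand: "(\<Sum>j=1..K. of_int (rearr (S i) (S j)) \<cdot> D_rep S j) = vec (S i)"
    if i: "i \<in> {1..K}" for i
  proof -
    have self: "rearr (S i) (S i) = 1"
      using assms(2) S[OF i] by (intro rearr_self) auto
    have "rearr (S i) (S j) = 0" if "j \<in> {1..K} - {1..i}" for j
      using assms(2) S[OF i] S[of j] assms(8)[of i j] that i
      by (intro rearr_eq_0_if_less) auto
    then have "(\<Sum>j=1..K. of_int (rearr (S i) (S j)) \<cdot> D_rep S j) =
        (\<Sum>j=1..i. of_int (rearr (S i) (S j)) \<cdot> D_rep S j)"
      using i by (intro sum.mono_neutral_right) auto
    also have "{1..i} = insert i {1..<i}"
      using i by auto
    also have "(\<Sum>j\<in>insert i {1..<i}. of_int (rearr (S i) (S j)) \<cdot> D_rep S j) =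
        D_rep S i + (\<Sum>j\<in>{1..<i}. of_int (rearr (S i) (S j)) \<cdot> D_rep S j)"
      by (simp add: self)
    also have "\<dots> = vec (S i)"
      by (subst D_rep.simps) simp
    finally show ?thesis .
  qed
  \<comment> \<open>The quotient has entered only through \<open>coeff\<close>; from here the two
    representatives are shown to be equal as vectors.\<close>
  have "(\<Sum>j=1..K. of_int (rearr F (S j)) \<cdot> D_rep S j) =
      (\<Sum>j=1..K. \<Sum>i=1..K. a i \<cdot> of_int (rearr (S i) (S j)) \<cdot> D_rep S j)"
    by (simp add: coeff fvec.scale_sum_left)
  also have "\<dots> = (\<Sum>i=1..K. \<Sum>j=1..K. a i \<cdot> of_int (rearr (S i) (S j)) \<cdot> D_rep S j)"
    by (rule sum.swap)
  also have "\<dots> = (\<Sum>i=1..K. a i \<cdot> vec (S i))"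
    by (intro sum.cong refl) (simp only: expand fvec.scale_sum_right[symmetric])
  finally show ?thesis
    by simp
qed

end
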